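(* Let $X=\{a_1,\dots,a_n\}$ and let $\mathcal{F}$ be a union-closed family of subsets of $X$ with $\bigcup_{f\in\mathcal{F}}f=X$. Let $w=a_1a_2\cdots a_n$ and $\mathcal{U}=\varphi_w(\mathcal{F})$. Then $$|J(\mathcal{F})|\le 2|\min(\mathcal{U})|+|\min(\mathcal{U}\setminus\min(\mathcal{U}))|.$$
   Context: A family $\mathcal{F}$ is union-closed if $f,g\in\mathcal{F}$ implies $f\cup g\in\mathcal{F}$. $J(\mathcal{F})$ is the set of $g\in\mathcal{F}$ such that $g=h\cup t$ with $h,t\in\mathcal{F}$ implies $h=g$ or $t=g$. For a family $\mathcal{B}$, $\min(\mathcal{B})$ is its set of inclusion-minimal members. Rising functions: for $S\subseteq 2^X$ and $a\in X$, $\varphi_{S,a}:S\to 2^X$ is $\varphi_{S,a}(z)=z\cup\{a\}$ if $z\cup\{a\}\notin S$, and $\varphi_{S,a}(z)=z$ otherwise. For a word $u=b_1\cdots b_n$ listing the elements of $X$ in some order, put $\varphi_0=\mathrm{id}$, $S_0=S$ and, for $1\le j\le n$, $\varphi_j=\varphi_{S_{j-1},b_j}\circ\varphi_{j-1}$, $S_j=\varphi_j(S)$; then $\varphi_u:=\varphi_n:S\to 2^X$ is the rising function of $S$ with respect to $u$. *)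

theory Defs
  imports Main
begin

definition union_closed :: "'a set set \<Rightarrow> bool" where
  "union_closed F \<longleftrightarrow> (\<forall>f\<in>F. \<forall>g\<in>F. f \<union> g \<in> F)"

text \<open>The empty set belongs to \<open>join_irreducibles F\<close> whenever it belongs to \<open>F\<close>.\<close>

definition join_irreducibles :: "'a set set \<Rightarrow> 'a set set" where
  "join_irreducibles F = {g \<in> F. \<forall>h\<in>F. \<forall>t\<in>F. g = h \<union> t \<longrightarrow> h = g \<or> t = g}"

definition minimal_members :: "'a set set \<Rightarrow> 'a set set" where
  "minimal_members B = {m \<in> B. \<forall>b\<in>B. b \<subseteq> m \<longrightarrow> b = m}"

text \<open>
  The functions below are total; only their values on members of \<open>S\<close> matter.
  The letters of a word \<open>u\<close> are \<open>u ! 0, \<dots>, u ! (length u - 1)\<close>, and they are processed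
  from left to right.
\<close>

definition rise :: "'a set set \<Rightarrow> 'a \<Rightarrow> 'a set \<Rightarrow> 'a set" where
  "rise S a z = (if z \<union> {a} \<notin> S then z \<union> {a} else z)"

fun rising_step :: "'a set set \<Rightarrow> 'a list \<Rightarrow> nat \<Rightarrow> 'a set \<Rightarrow> 'a set" where
  "rising_step S u 0 = id"
| "rising_step S u (Suc j) = rise (rising_step S u j ` S) (u ! j) \<circ> rising_step S u j"

definition rising_function :: "'a set set \<Rightarrow> 'a list \<Rightarrow> 'a set \<Rightarrow> 'a set" where
  "rising_function S u = rising_step S u (length u)"

end

theory Submission
  imports Defs
begin

text \<open>
  Write \<open>\<phi>\<close> for the rising function of \<open>F\<close>. Then \<open>\<phi>\<inverse>(u)\<close> is the largest member of \<open>F\<close>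
  inside \<open>u\<close>, so \<open>\<phi>\<close> is injective, and the join-irreducible \<open>g\<close> with \<open>\<phi>(g)\<close> in \<open>min U\<close> or in
  \<open>min (U - min U)\<close> are accounted for by the terms \<open>|min U|\<close> and \<open>|min (U - min U)|\<close>. A remaining \<open>g\<close>
  has a largest member \<open>g'\<close> of \<open>F\<close> strictly below it, and \<open>g \<mapsto> \<phi>(g')\<close> is an injection of these
  \<open>g\<close> into \<open>min U\<close>. Both claims about this map follow by looking at the first letter \<open>r\<close>
  on which two values of \<open>\<phi>\<close> differ: a set \<open>\<phi>(k)\<close> can omit \<open>r\<close> only if some member of \<open>F\<close>
  contains \<open>r\<close> and otherwise lies in \<open>k\<close> together with the letters of \<open>\<phi>(k)\<close> preceding \<open>r\<close>.
\<close>

text \<open>\<open>rising_step\<close> recurses at the end of the word. Peeling off the first letter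
  instead allows induction on the word with the family kept arbitrary.\<close>

lemma rising_step_Cons:
  "rising_step S (a # w) (Suc j) = rising_step (rise S a ` S) w j \<circ> rise S a"
proof (induction j)
  case (Suc j)
  have "rising_step S (a # w) (Suc (Suc j))
      = rise (rising_step S (a # w) (Suc j) ` S) (w ! j) \<circ> rising_step S (a # w) (Suc j)"
    by simp
  also have "\<dots> = rising_step (rise S a ` S) w (Suc j) \<circ> rise S a"
    unfolding Suc by (simp add: image_comp comp_assoc)
  finally show ?case .
qed simp

lemma rising_function_Nil [simp]: "rising_function S [] z = z"
  by (simp add: rising_function_def)

lemma rising_function_Cons [simp]:
  "rising_function S (a # w) z = rising_function (rise S a ` S) w (rise S a z)"
  by (simp only: rising_function_def length_Cons rising_step_Cons comp_apply)

lemma rise_bounds: "z \<subseteq> rise S a z" "rise S a z \<subseteq> insert a z"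
  by (auto simp: rise_def)

lemma rising_function_upper: "z \<subseteq> rising_function S w z"
proof (induction w arbitrary: S z)
  case (Cons a w)
  then show ?case using rise_bounds(1)[of z S a] by force
qed simp

lemma rising_function_bound: "rising_function S w z \<subseteq> z \<union> set w"
proof (induction w arbitrary: S z)
  case (Cons a w)
  then show ?case using rise_bounds(2)[of S a z] by fastforce
qed simp

text \<open>If \<open>f\<close> or \<open>g\<close> contains \<open>a\<close>, the union of their
  preimages equals \<open>f \<union> g\<close> up to \<open>a\<close>, which is enough for a set
  containing \<open>a\<close>. If neither does, both were blocked, so \<open>S\<close> contains
  \<open>f \<union> g\<close> as well as \<open>insert a (f \<union> g)\<close>.\<close>

lemma union_closed_rise:
  assumes "union_closed S"
  shows "union_closed (rise S a ` S)"
proof -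
  have *: "x \<in> rise S a ` S \<longleftrightarrow>
      (if a \<in> x then x \<in> S \<or> x - {a} \<in> S else x \<in> S \<and> insert a x \<in> S)" for x
  proof (cases "a \<in> x")
    case True
    have "x \<in> S \<or> x - {a} \<in> S" if "x \<in> rise S a ` S"
    proof -
      obtain y where "y \<in> S" "x = rise S a y" using \<open>x \<in> rise S a ` S\<close> by blast
      then show ?thesis
        using True by (cases "a \<in> y") (auto simp: rise_def insert_absorb split: if_splits)
    qed
    moreover have "x \<in> rise S a ` S" if "x \<in> S"
      using that True by (intro image_eqI[of _ _ x]) (auto simp: rise_def insert_absorb)
    moreover have "x \<in> rise S a ` S" if "x - {a} \<in> S" "x \<notin> S"
      using that True by (intro image_eqI[of _ _ "x - {a}"]) (auto simp: rise_def insert_absorb)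
    ultimately show ?thesis using True by auto
  next
    case False
    then show ?thesis by (auto simp: rise_def image_iff split: if_splits)
  qed
  have uc: "f \<union> g \<in> S" if "f \<in> S" "g \<in> S" for f g
    using assms that by (auto simp: union_closed_def)
  have in_left: "f \<union> g \<in> rise S a ` S" if fg: "f \<in> rise S a ` S" "g \<in> rise S a ` S" and "a \<in> f" for f g
  proof -
    obtain f0 g0 where "f0 \<in> S" "g0 \<in> S" "f = rise S a f0" "g = rise S a g0"
      using fg by blast
    then have "f0 \<union> g0 \<in> S" "f0 \<union> g0 = f \<union> g \<or> f0 \<union> g0 = f \<union> g - {a}"
      using uc rise_bounds(1)[of f0 S a] rise_bounds(1)[of g0 S a]
        rise_bounds(2)[of S a f0] rise_bounds(2)[of S a g0] \<open>a \<in> f\<close> by blast+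
    then show ?thesis using * \<open>a \<in> f\<close> by auto
  qed
  show ?thesis
    unfolding union_closed_def
  proof (intro ballI)
    fix f g assume fg: "f \<in> rise S a ` S" "g \<in> rise S a ` S"
    show "f \<union> g \<in> rise S a ` S"
    proof (cases "a \<in> f \<or> a \<in> g")
      case True
      then show ?thesis using in_left fg by (metis sup_commute)
    next
      case False
      then have "f \<in> S" "g \<in> S" "insert a f \<in> S" using fg * by auto
      then have "f \<union> g \<in> S" "insert a (f \<union> g) \<in> S" using uc[of f g] uc[of "insert a f" g] by auto
      then show ?thesis using * False by auto
    qed
  qed
qed

text \<open>By induction on the word, comparing \<open>f\<close> and \<open>g\<close> after the
  first letter. It is this equivalence that makes \<open>g\<close> the largest member of
  \<open>S\<close> inside its value.\<close>

lemma subset_rising_function_iff: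
  assumes "union_closed S" "f \<in> S" "g \<in> S"
  shows "f \<subseteq> rising_function S w g \<longleftrightarrow> f \<subseteq> g"
proof
  show "f \<subseteq> g" if "f \<subseteq> rising_function S w g"
    using assms that
  proof (induction w arbitrary: S f g)
    case (Cons a w)
    let ?T = "rise S a ` S" and ?R = "rising_function S (a # w) g"
    have uc: "x \<union> y \<in> S" if "x \<in> S" "y \<in> S" for x y
      using Cons.prems(1) that by (auto simp: union_closed_def)
    have IH: "t \<subseteq> rise S a g" if "t \<in> ?T" "t \<subseteq> ?R" for t
      using Cons.IH[of ?T t "rise S a g"] union_closed_rise[OF Cons.prems(1)] that Cons.prems(3)
      by auto
    have "rise S a g \<subseteq> ?R" using rising_function_upper by simp
    show ?case
    proof (cases "a \<in> ?R")
      case True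
      then have "rise S a f \<subseteq> ?R" using Cons.prems(4) rise_bounds(2)[of S a f] by blast
      then have "f \<subseteq> rise S a g" using IH Cons.prems(2) rise_bounds(1)[of f S a] by blast
      \<comment> \<open>In the second case \<open>insert a g\<close> is a member of
        \<open>S\<close>, so \<open>g\<close> was not raised and the two cases coincide.\<close>
      then have "f \<union> g = g \<or> f \<union> g = insert a g" using rise_bounds(2)[of S a g] by auto
      then show ?thesis
        using uc[OF Cons.prems(2,3)] \<open>f \<subseteq> rise S a g\<close> by (auto simp: rise_def split: if_splits)
    next
      case False
      then have g: "rise S a g = g" "insert a g \<in> S"
        using \<open>rise S a g \<subseteq> ?R\<close> by (auto simp: rise_def split: if_splits)
      \<comment> \<open>Raising \<open>f\<close> itself could add \<open>a\<close> and leave the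
        value of \<open>g\<close>; \<open>f \<union> g\<close> stays fixed because
        \<open>insert a g\<close> blocks it.\<close>
      then have "rise S a (f \<union> g) = f \<union> g"
        using uc[OF Cons.prems(2) g(2)] by (auto simp: rise_def)
      moreover have "f \<union> g \<in> S" using uc Cons.prems by blast
      ultimately have "f \<union> g \<in> ?T" by (metis imageI)
      moreover have "f \<union> g \<subseteq> ?R" using Cons.prems(4) \<open>rise S a g \<subseteq> ?R\<close> g(1) by auto
      ultimately show ?thesis using IH g(1) by blast
    qed
  qed simp
qed (use rising_function_upper[of g S w] in blast)

lemma rising_function_inj:
  assumes "union_closed S"
  shows "inj_on (rising_function S w) S"
proof (rule inj_onI)
  fix f g assume fg: "f \<in> S" "g \<in> S" "rising_function S w f = rising_function S w g"
  then have "f \<subseteq> rising_function S w g" "g \<subseteq> rising_function S w f"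
    using rising_function_upper by metis+
  then show "f = g" using subset_rising_function_iff[OF assms] fg(1,2) by blast
qed

text \<open>The letter \<open>a\<close> is refused only if adding it yields a set already in the
  current family. The preimage of that set in \<open>S\<close> is the required \<open>k\<close>:
  raising along \<open>p\<close> cannot have added \<open>a\<close>, and it only enlarges
  sets.\<close>

lemma rising_function_omits:
  assumes "h \<in> S" "a \<notin> set p" "a \<notin> rising_function S (p @ a # s) h"
  shows "\<exists>k\<in>S. a \<in> k \<and> k \<subseteq> h \<union> (rising_function S (p @ a # s) h \<inter> set p) \<union> {a}"
  using assms
proof (induction p arbitrary: S h)
  case Nil
  have "rise S a h \<subseteq> rising_function S ([] @ a # s) h"
    by (simp add: rising_function_upper)
  then have "insert a h \<in> S"
    using Nil.prems by (auto simp: rise_def split: if_splits)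
  then show ?case by (intro bexI[of _ "insert a h"]) auto
next
  case (Cons b p)
  let ?R = "rising_function S ((b # p) @ a # s) h"
  obtain k1 where k1: "k1 \<in> rise S b ` S" "a \<in> k1" "k1 \<subseteq> rise S b h \<union> (?R \<inter> set p) \<union> {a}"
    using Cons.IH[of "rise S b h" "rise S b ` S"] Cons.prems by auto
  then obtain k where k: "k \<in> S" "k1 = rise S b k" by blast
  have "rise S b h \<subseteq> ?R" by (simp add: rising_function_upper)
  then have "rise S b h \<subseteq> h \<union> (?R \<inter> {b})" using rise_bounds(2)[of S b h] by blast
  moreover have "k \<subseteq> k1" "a \<in> k"
    using k(2) k1(2) Cons.prems(2) rise_bounds(1)[of k S b] rise_bounds(2)[of S b k] by auto
  ultimately show ?case using k(1) k1(3) by (intro bexI[of _ k]) auto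
qed

text \<open>The relation is oriented, since the two orientations need different arguments later. The
  split of \<open>w\<close> matches the one in \<open>rising_function_omits\<close>.\<close>

definition first_difference :: "'a list \<Rightarrow> 'a set \<Rightarrow> 'a set \<Rightarrow> 'a \<Rightarrow> bool" where
  "first_difference w A B r \<longleftrightarrow>
    r \<in> A \<and> r \<notin> B \<and> (\<exists>p s. w = p @ r # s \<and> (\<forall>c\<in>set p. c \<in> A \<longleftrightarrow> c \<in> B))"

lemma first_difference_exists:
  assumes "A \<subseteq> set w" "B \<subseteq> set w" "A \<noteq> B"
  shows "\<exists>r. first_difference w A B r \<or> first_difference w B A r"
proof -
  have "\<exists>c\<in>set w. (c \<in> A) \<noteq> (c \<in> B)" using assms by blast
  from split_list_first_prop[OF this] show ?thesis
    unfolding first_difference_def by metis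
qed

text \<open>The value of \<open>k\<close> also omits \<open>r\<close>, so
  \<open>rising_function_omits\<close> yields \<open>m\<close>. Its letters from the prefix lie in
  the value of \<open>f2\<close>, hence in that of \<open>f1\<close>, because both agree before
  \<open>r\<close>; thus \<open>m\<close> lies in the value of \<open>f1\<close> and so in
  \<open>f1\<close>.\<close>

lemma first_difference_member:
  assumes "union_closed F" "f1 \<in> F" "k \<in> F"
    and r: "first_difference w (rising_function F w f1) (rising_function F w f2) r"
    and k: "rising_function F w k \<subseteq> rising_function F w f2" "k \<subseteq> f1"
  shows "\<exists>m\<in>F. r \<in> m \<and> m \<subseteq> f1 \<and> m \<subseteq> insert r (rising_function F w k)"
proof -
  let ?\<phi> = "rising_function F w"
  obtain p s where w: "w = p @ r # s" "\<forall>c\<in>set p. c \<in> ?\<phi> f1 \<longleftrightarrow> c \<in> ?\<phi> f2"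
    and r: "r \<in> ?\<phi> f1" "r \<notin> ?\<phi> f2"
    using r unfolding first_difference_def by blast
  obtain m where m: "m \<in> F" "r \<in> m" "m \<subseteq> k \<union> (?\<phi> k \<inter> set p) \<union> {r}"
    using rising_function_omits[of k F r p s] assms(3) w r k(1) by blast
  have "m \<subseteq> ?\<phi> f1"
    using m(3) w(2) r(1) k rising_function_upper[of f1 F w] by blast
  then have "m \<subseteq> f1" using subset_rising_function_iff assms(1,2) m(1) by blast
  moreover have "m \<subseteq> insert r (?\<phi> k)"
    using m(3) rising_function_upper[of k F w] by blast
  ultimately show ?thesis using m by blast
qed

text \<open>The member obtained at \<open>r\<close> lies in \<open>g\<close> but not in
  \<open>h\<close>, so it must be \<open>g\<close> itself. Hence \<open>g\<close>, and with it
  \<open>h\<close>, lies in the value of \<open>k\<close> up to \<open>r\<close>, which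
  \<open>h\<close> omits; this forces \<open>h \<subseteq> k\<close>.\<close>

lemma first_difference_lower_cover:
  assumes "union_closed F" "g \<in> F" "h \<in> F" "k \<in> F" "h \<subset> g" "h \<subseteq> f"
    and h: "\<And>m. m \<in> F \<Longrightarrow> m \<subset> g \<Longrightarrow> m \<subseteq> h"
    and r: "first_difference w (rising_function F w g) (rising_function F w f) r"
    and k: "rising_function F w k \<subseteq> rising_function F w f" "k \<subseteq> h"
  shows "k = h"
proof -
  have "r \<notin> h"
    using r \<open>h \<subseteq> f\<close> rising_function_upper[of f F w] unfolding first_difference_def by blast
  obtain m where m: "m \<in> F" "r \<in> m" "m \<subseteq> g" "m \<subseteq> insert r (rising_function F w k)"
    using first_difference_member[OF assms(1,2,4) r k(1)] k(2) \<open>h \<subset> g\<close> by blast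
  have "m = g" using h m \<open>r \<notin> h\<close> by blast
  then have "h \<subseteq> rising_function F w k" using m(4) \<open>h \<subset> g\<close> \<open>r \<notin> h\<close> by blast
  then show ?thesis using subset_rising_function_iff assms(1,3,4) k(2) by blast
qed

text \<open>Join-irreducibility rules out that two members strictly below \<open>g\<close> have
  union \<open>g\<close>; finite induction extends this to \<open>A\<close>. Nonemptiness matters
  because the empty union need not belong to \<open>F\<close>.\<close>

lemma Union_below_join_irreducible:
  assumes "union_closed F" "g \<in> join_irreducibles F" "finite A" "A \<noteq> {}"
    and "\<And>f. f \<in> A \<Longrightarrow> f \<in> F \<and> f \<subset> g"
  shows "\<Union>A \<in> F \<and> \<Union>A \<subset> g"
  using assms(3-5)
proof (induction A rule: finite_ne_induct)
  case (insert f A)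
  then have A: "f \<in> F" "f \<subset> g" "\<Union>A \<in> F" "\<Union>A \<subset> g" by auto
  then have "f \<union> \<Union>A \<in> F" using assms(1) by (auto simp: union_closed_def)
  moreover have "g \<noteq> f \<union> \<Union>A" using assms(2) A unfolding join_irreducibles_def by blast
  ultimately show ?case using A by auto
qed auto

theorem theorem6p5:
  fixes X :: "'a set" and w :: "'a list" and F U :: "'a set set"
  assumes "distinct w" and "set w = X"
    and "F \<subseteq> Pow X" and "union_closed F" and "\<Union>F = X"
    and "U = rising_function F w ` F"
  shows "card (join_irreducibles F)
    \<le> 2 * card (minimal_members U) + card (minimal_members (U - minimal_members U))"
proof -
  let ?\<phi> = "rising_function F w"
  let ?J = "join_irreducibles F"
  let ?M = "minimal_members U"
  let ?N = "minimal_members (U - ?M)"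
  \<comment> \<open>This is the \<open>g'\<close> of the overview; it is shown to be a member of
    \<open>F\<close> only for \<open>g\<close> in \<open>K\<close>.\<close>
  define lower where "lower g = \<Union>{f \<in> F. f \<subset> g}" for g
  define K where "K = {g \<in> ?J. ?\<phi> g \<notin> ?M \<and> ?\<phi> g \<notin> ?N}"
  have "finite F"
    using assms(2,3) by (metis List.finite_set finite_Pow_iff finite_subset)
  have finU: "finite U" using \<open>finite F\<close> assms(6) by simp
  have JF: "?J \<subseteq> F" by (auto simp: join_irreducibles_def)
  have MU: "?M \<subseteq> U" "?N \<subseteq> U" by (auto simp: minimal_members_def)
  note iff = subset_rising_function_iff[OF assms(4), of _ _ w]
  have bound: "?\<phi> f \<subseteq> set w" if "f \<in> F" for f
    using rising_function_bound[of F w f] that assms(2,3) by blast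
  have inj: "inj_on ?\<phi> F" using rising_function_inj assms(4) by blast
  have mono: "f \<subset> g" if "f \<in> F" "g \<in> F" "?\<phi> f \<subset> ?\<phi> g" for f g
    using that iff[of f g] rising_function_upper[of f F w] by blast
  have below: "f \<subseteq> lower g" if "f \<in> F" "f \<subset> g" for f g
    using that by (auto simp: lower_def)
  have nonmin: "\<exists>k\<in>F. ?\<phi> k \<subset> ?\<phi> f" if "f \<in> F" "?\<phi> f \<notin> ?M" for f
    using that assms(6) unfolding minimal_members_def by blast
  have lower: "lower g \<in> F" "lower g \<subset> g" if "g \<in> K" for g
  proof -
    have g: "g \<in> ?J" "g \<in> F" "?\<phi> g \<notin> ?M" using that JF by (auto simp: K_def)
    \<comment> \<open>Since \<open>?\<phi> g\<close> is not minimal, some member of \<open>F\<close>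
      does lie strictly below \<open>g\<close>.\<close>
    obtain k where "k \<in> F" "?\<phi> k \<subset> ?\<phi> g" using nonmin[OF g(2,3)] by blast
    then have "k \<in> {f \<in> F. f \<subset> g}" using mono[of k g] g(2) by simp
    then have "{f \<in> F. f \<subset> g} \<noteq> {}" by (metis empty_iff)
    then have "lower g \<in> F \<and> lower g \<subset> g"
      unfolding lower_def
      by (intro Union_below_join_irreducible[OF assms(4) g(1)]) (simp_all add: \<open>finite F\<close>)
    then show "lower g \<in> F" "lower g \<subset> g" by simp_all
  qed
  have lower_min: "?\<phi> (lower g) \<in> ?M" if "g \<in> K" for g
  proof (rule ccontr)
    assume "?\<phi> (lower g) \<notin> ?M"
    note low = lower[OF that]
    have g: "g \<in> F" "?\<phi> g \<notin> ?M" using that JF by (auto simp: K_def)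
    obtain k where k: "k \<in> F" "?\<phi> k \<subset> ?\<phi> g" using nonmin g by blast
    obtain k' where k': "k' \<in> F" "?\<phi> k' \<subset> ?\<phi> (lower g)"
      using nonmin low(1) \<open>?\<phi> (lower g) \<notin> ?M\<close> by blast
    have "?\<phi> g \<noteq> ?\<phi> (lower g)" using inj_onD[OF inj _ g(1) low(1)] low(2) by blast
    then obtain r where "first_difference w (?\<phi> (lower g)) (?\<phi> g) r
        \<or> first_difference w (?\<phi> g) (?\<phi> (lower g)) r"
      using first_difference_exists[OF bound[OF g(1)] bound[OF low(1)]] by blast
    then show False
    proof
      \<comment> \<open>Here \<open>r\<close> would belong to a member inside
        \<open>lower g\<close>, hence to \<open>g\<close>, although \<open>?\<phi> g\<close> omits
        it.\<close>
      assume r: "first_difference w (?\<phi> (lower g)) (?\<phi> g) r"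
      have "k \<subseteq> lower g" using below[OF k(1) mono[OF k(1) g(1) k(2)]] .
      then obtain m where "r \<in> m" "m \<subseteq> lower g"
        using first_difference_member[OF assms(4) low(1) k(1) r] k(2) by blast
      then show False
        using r low(2) rising_function_upper[of g F w] unfolding first_difference_def by blast
    next
      \<comment> \<open>Here a value strictly below \<open>?\<phi> (lower g)\<close> would have to
        come from \<open>lower g\<close> itself.\<close>
      assume r: "first_difference w (?\<phi> g) (?\<phi> (lower g)) r"
      have "k' \<subseteq> lower g" using mono[OF k'(1) low(1) k'(2)] by blast
      then have "k' = lower g"
        using first_difference_lower_cover[OF assms(4) g(1) low(1) k'(1) low(2) order_refl below r]
          k'(2) by blast
      then show False using k'(2) by blast
    qed
  qed
  have no_first: False
    if "g1 \<in> K" "g2 \<in> K" "lower g1 = lower g2" "first_difference w (?\<phi> g1) (?\<phi> g2) r"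
    for g1 g2 r
  proof -
    have g: "g1 \<in> F" "g2 \<in> F" "?\<phi> g2 \<notin> ?M" "?\<phi> g2 \<notin> ?N" using that JF by (auto simp: K_def)
    \<comment> \<open>Exclusion of \<open>?N\<close> enters here: the value below
      \<open>?\<phi> g2\<close> can be chosen nonminimal, whereas \<open>lower g1\<close>, with
      which \<open>k\<close> will coincide, has a minimal value.\<close>
    obtain k where k: "k \<in> F" "?\<phi> k \<subset> ?\<phi> g2" "?\<phi> k \<notin> ?M"
      using g assms(6) unfolding minimal_members_def[of "U - ?M"] by blast
    have "k \<subseteq> lower g1" using below[OF k(1) mono[OF k(1) g(2) k(2)]] that(3) by simp
    moreover have "lower g1 \<subseteq> g2" using that(3) lower(2)[OF that(2)] by auto
    ultimately have "k = lower g1"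
      using first_difference_lower_cover[OF assms(4) g(1) lower(1)[OF that(1)] k(1)
          lower(2)[OF that(1)] _ below that(4)] k(2) by blast
    then show False using lower_min[OF that(1)] k(3) by simp
  qed
  have "inj_on (\<lambda>g. ?\<phi> (lower g)) K"
  proof (rule inj_onI, rule ccontr)
    fix g1 g2 assume g: "g1 \<in> K" "g2 \<in> K" "?\<phi> (lower g1) = ?\<phi> (lower g2)" "g1 \<noteq> g2"
    have low: "lower g1 = lower g2" using inj_onD[OF inj g(3)] lower(1) g(1,2) by blast
    have gF: "g1 \<in> F" "g2 \<in> F" using g JF by (auto simp: K_def)
    then have "?\<phi> g1 \<noteq> ?\<phi> g2" using inj_onD[OF inj _ gF] g(4) by blast
    then obtain r where "first_difference w (?\<phi> g1) (?\<phi> g2) r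
        \<or> first_difference w (?\<phi> g2) (?\<phi> g1) r"
      using first_difference_exists[OF bound[OF gF(1)] bound[OF gF(2)]] by blast
    then show False
      using no_first[OF g(1,2) low] no_first[OF g(2,1) low[symmetric]] by blast
  qed
  then have "card K \<le> card ?M"
    by (rule card_inj_on_le) (use lower_min finU MU in \<open>auto intro: finite_subset\<close>)
  moreover have "card {g \<in> ?J. ?\<phi> g \<in> B} \<le> card B" if "B \<subseteq> U" for B
    by (rule card_inj_on_le[of ?\<phi>])
      (use that finU JF in \<open>auto intro: finite_subset inj_on_subset[OF inj]\<close>)
  then have "card {g \<in> ?J. ?\<phi> g \<in> ?M} \<le> card ?M" "card {g \<in> ?J. ?\<phi> g \<in> ?N} \<le> card ?N"
    using MU by blast+
  \<comment> \<open>The first class and \<open>K\<close> each contribute at most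
    \<open>card ?M\<close>, which gives the factor 2.\<close>
  moreover have "?J = ({g \<in> ?J. ?\<phi> g \<in> ?M} \<union> {g \<in> ?J. ?\<phi> g \<in> ?N}) \<union> K"
    by (auto simp: K_def)
  then have "card ?J \<le> card {g \<in> ?J. ?\<phi> g \<in> ?M} + card {g \<in> ?J. ?\<phi> g \<in> ?N} + card K"
    by (metis (no_types, lifting) card_Un_le add_le_mono1 order_trans)
  ultimately show ?thesis by linarith
qed

end
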